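(* If $f:X\to X$ is a distal homeomorphism of a compact metric space $X$, then $Sh(f)\subset X^{deg}$.
   Context: Let $f:X\to X$ be a homeomorphism of a metric space $(X,d)$. For $\delta>0$, a bi-infinite sequence $\xi=(\xi_n)_{n\in\mathbb{Z}}$ of points of $X$ is a $\delta$-pseudo-orbit if $d(f(\xi_n),\xi_{n+1})\leq\delta$ for all $n\in\mathbb{Z}$. For $\epsilon>0$, $\xi$ can be $\epsilon$-shadowed if there is $x\in X$ such that $d(f^n(x),\xi_n)\leq\epsilon$ for all $n\in\mathbb{Z}$. A point $x\in X$ is shadowable if for every $\epsilon>0$ there is $\delta>0$ such that every $\delta$-pseudo-orbit $\xi$ with $\xi_0=x$ can be $\epsilon$-shadowed. $Sh(f)$ denotes the set of shadowable points of $f$. The homeomorphism $f$ is distal if $\inf_{n\in\mathbb{Z}}d(f^n(x),f^n(y))>0$ for all distinct points $x,y\in X$. $X$ is totally disconnected at $p\in X$ if the connected component of $X$ containing $p$ is $\{p\}$, and $X^{deg}=\{p\in X: X\text{ is totally disconnected at }p\}$. *)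

theory Defs
  imports "HOL-Analysis.Analysis"
begin

text \<open>
  The metric space is a carrier set \<open>X\<close> in a type of class \<open>metric_space\<close>, with the induced
  distance; a self-map of \<open>X\<close> is a function whose values outside \<open>X\<close> are irrelevant.
\<close>

definition self_homeomorphism :: "'a::metric_space set \<Rightarrow> ('a \<Rightarrow> 'a) \<Rightarrow> bool" where
  "self_homeomorphism X f \<longleftrightarrow> (\<exists>g. homeomorphism X X f g)"

text \<open>
  Integer iterates. The inverse is taken relative to \<open>X\<close>, so this is \<open>f\<^sup>n\<close> only when
  \<open>f\<close> is a bijection of \<open>X\<close> onto itself and the iterate is applied to a point of \<open>X\<close>.
\<close>

definition int_iterate :: "'a set \<Rightarrow> ('a \<Rightarrow> 'a) \<Rightarrow> int \<Rightarrow> 'a \<Rightarrow> 'a" where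
  "int_iterate X f n =
     (if n \<ge> 0 then f ^^ nat n else inv_into X f ^^ nat (- n))"

definition pseudo_orbit ::
    "'a::metric_space set \<Rightarrow> ('a \<Rightarrow> 'a) \<Rightarrow> real \<Rightarrow> (int \<Rightarrow> 'a) \<Rightarrow> bool" where
  "pseudo_orbit X f \<delta> \<xi> \<longleftrightarrow>
     (\<forall>n. \<xi> n \<in> X) \<and> (\<forall>n. dist (f (\<xi> n)) (\<xi> (n + 1)) \<le> \<delta>)"

definition can_be_shadowed ::
    "'a::metric_space set \<Rightarrow> ('a \<Rightarrow> 'a) \<Rightarrow> real \<Rightarrow> (int \<Rightarrow> 'a) \<Rightarrow> bool" where
  "can_be_shadowed X f \<epsilon> \<xi> \<longleftrightarrow>
     (\<exists>x\<in>X. \<forall>n. dist (int_iterate X f n x) (\<xi> n) \<le> \<epsilon>)"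

definition shadowable_point ::
    "'a::metric_space set \<Rightarrow> ('a \<Rightarrow> 'a) \<Rightarrow> 'a \<Rightarrow> bool" where
  "shadowable_point X f x \<longleftrightarrow>
     (\<forall>\<epsilon>>0. \<exists>\<delta>>0. \<forall>\<xi>. pseudo_orbit X f \<delta> \<xi> \<and> \<xi> 0 = x \<longrightarrow> can_be_shadowed X f \<epsilon> \<xi>)"

definition Sh :: "'a::metric_space set \<Rightarrow> ('a \<Rightarrow> 'a) \<Rightarrow> 'a set" where
  "Sh X f = {x \<in> X. shadowable_point X f x}"

definition distal :: "'a::metric_space set \<Rightarrow> ('a \<Rightarrow> 'a) \<Rightarrow> bool" where
  "distal X f \<longleftrightarrow>
     (\<forall>x\<in>X. \<forall>y\<in>X. x \<noteq> y \<longrightarrow>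
        (INF n. dist (int_iterate X f n x) (int_iterate X f n y)) > 0)"

definition totally_disconnected_at :: "'a::metric_space set \<Rightarrow> 'a \<Rightarrow> bool" where
  "totally_disconnected_at X p \<longleftrightarrow> connected_component_set X p = {p}"

definition Xdeg :: "'a::metric_space set \<Rightarrow> 'a set" where
  "Xdeg X = {p \<in> X. totally_disconnected_at X p}"

end

theory Submission
  imports Defs
begin

text \<open>
  Let \<open>p\<close> be shadowable and let \<open>q\<close> lie in its component; the claim is that \<open>dist p q\<close> is below
  every positive bound. The dynamical input is Ellis' theorem that distality forces the identity to be a pointwise
  limit of arbitrarily high iterates (\<open>forward_distal_imp_jointly_recurrent\<close>): the pointwise limits
  of iterates form a compact semigroup of maps, such a semigroup contains an idempotent \<open>u\<close>
  (\<open>compact_semigroup_idempotent\<close>), and since \<open>u\<close> identifies \<open>u x\<close> with \<open>x\<close>, distality gives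
  \<open>u x = x\<close>. So any finite set of points returns simultaneously, under \<open>f\<close> and likewise under its
  inverse, which is distal as well.

  Returns let pseudo-orbits drift inside the component: following the orbit of a point until it
  comes back, a pseudo-orbit may then jump to any nearby point. Because the returns are simultaneous, each step
  of the drift can use a return time that almost fixes \<open>p\<close> too. Connectedness therefore yields a
  pseudo-orbit from \<open>p\<close> to \<open>q\<close> of some length \<open>N\<close> for which \<open>f\<^sup>N p\<close> is still close to \<open>p\<close>
  (\<open>chain_within_connected\<close>).

  Put the past orbit of \<open>p\<close> before this chain and the future orbit of \<open>q\<close> after it, and shadow the
  result by the orbit of \<open>x\<close>. In the past, the orbits of \<open>x\<close> and \<open>p\<close> stay close. The points \<open>f\<^sup>N x\<close>
  and \<open>f\<^sup>N p\<close> are jointly recurrent under the inverse, so they are nearly attained in that past, and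
  are therefore close to each other as well. But \<open>f\<^sup>N x\<close> is close to \<open>q\<close> by shadowing and
  \<open>f\<^sup>N p\<close> is close to \<open>p\<close> by construction.
\<close>

section \<open>Idempotents in compact semigroups of maps\<close>

lemma compact_imp_closed_fun:
  fixes S :: "('b \<Rightarrow> 'a::t2_space) set"
  assumes "compact S"
  shows "closed S"
proof -
  have "Hausdorff_space (euclidean :: 'a topology)"
    unfolding Hausdorff_space_def disjnt_def using hausdorff by fastforce
  then have "Hausdorff_space (euclidean :: ('b \<Rightarrow> 'a) topology)"
    unfolding euclidean_product_topology[symmetric]
    by (simp only: Hausdorff_space_product_topology simp_thms ball_UNIV)
  then have "closedin euclidean S"
    using assms by (intro compactin_imp_closedin) auto
  then show ?thesis by simp
qed

lemma continuous_on_precomp: "continuous_on S (\<lambda>\<phi>::'b \<Rightarrow> 'a::topological_space. \<phi> \<circ> \<psi>)"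
  by (intro continuous_on_coordinatewise_then_product)
    (simp add: continuous_on_subset[OF continuous_on_product_coordinates])

definition compact_semigroup :: "('a::topological_space \<Rightarrow> 'a) set \<Rightarrow> bool" where
  "compact_semigroup S \<longleftrightarrow> compact S \<and> S \<noteq> {} \<and> (\<forall>\<phi>\<in>S. \<forall>\<psi>\<in>S. \<phi> \<circ> \<psi> \<in> S)"

text \<open>
  Zorn's lemma applies to reverse inclusion because the intersection of a chain of nonempty compact
  sets is nonempty.
\<close>

lemma minimal_compact_semigroup:
  fixes S :: "('a::t2_space \<Rightarrow> 'a) set"
  assumes S: "compact_semigroup S"
  obtains M where "compact_semigroup M" "M \<subseteq> S"
    "\<And>T. compact_semigroup T \<Longrightarrow> T \<subseteq> M \<Longrightarrow> T = M"
proof -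
  define A where "A = {T. T \<subseteq> S \<and> compact_semigroup T}"
  have "\<exists>M\<in>A. \<forall>T\<in>A. M \<supseteq> T \<longrightarrow> T = M"
  proof (rule predicate_Zorn)
    show "partial_order_on A (relation_of (\<supseteq>) A)"
      by (rule partial_order_on_relation_ofI) auto
  next
    fix C assume C: "C \<in> Chains (relation_of (\<supseteq>) A)"
    then have CA: "C \<subseteq> A" by (rule Chains_relation_of)
    have chain: "subset.chain UNIV C"
      using C by (auto simp: Chains_def relation_of_def subset_chain_def)
    show "\<exists>U\<in>A. \<forall>T\<in>C. T \<supseteq> U"
    proof (cases "C = {}")
      case True
      then show ?thesis using S by (auto simp: A_def)
    next
      case False
      have closed: "closed T" if "T \<in> C" for T
        using that CA compact_imp_closed_fun by (auto simp: A_def compact_semigroup_def)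
      have "S \<inter> \<Inter>C \<noteq> {}"
      proof (rule compact_imp_fip)
        show "compact S" using S by (simp add: compact_semigroup_def)
        fix B assume B: "finite B" "B \<subseteq> C"
        show "S \<inter> \<Inter>B \<noteq> {}"
        proof (cases "B = {}")
          case True
          then show ?thesis using S by (simp add: compact_semigroup_def)
        next
          case False
          have "\<Inter>B \<in> B"
            using B chain False by (intro Inter_in_chain[where \<A> = UNIV])
              (auto simp: subset_chain_def)
          then have "\<Inter>B \<in> A" using B CA by auto
          then show ?thesis by (auto simp: A_def compact_semigroup_def)
        qed
      qed (use closed in auto)
      moreover have "compact (S \<inter> \<Inter>C)"
        using S closed by (intro compact_Int_closed closed_Inter)
          (auto simp: compact_semigroup_def)
      moreover have "\<phi> \<circ> \<psi> \<in> S \<inter> \<Inter>C" if "\<phi> \<in> S \<inter> \<Inter>C" "\<psi> \<in> S \<inter> \<Inter>C" for \<phi> \<psi>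
        using that S CA by (auto simp: A_def compact_semigroup_def)
      ultimately have "S \<inter> \<Inter>C \<in> A" by (auto simp: A_def compact_semigroup_def)
      then show ?thesis by (rule bexI[rotated]) auto
    qed
  qed
  then obtain M where M: "M \<in> A" "\<And>T. T \<in> A \<Longrightarrow> T \<subseteq> M \<Longrightarrow> T = M" by auto
  show ?thesis
  proof (rule that)
    show "compact_semigroup M" "M \<subseteq> S" using M(1) by (auto simp: A_def)
    fix T assume T: "compact_semigroup T" "T \<subseteq> M"
    then have "T \<in> A" using M(1) by (auto simp: A_def)
    then show "T = M" using M(2) T(2) by blast
  qed
qed

text \<open>
  The Ellis--Numakura lemma. For \<open>u\<close> in a minimal \<open>M\<close>, the compact semigroup \<open>M \<circ> u\<close> must be
  all of \<open>M\<close>, so \<open>u = \<phi> \<circ> u\<close> for some \<open>\<phi>\<close>; the \<open>\<phi>\<close> with this property again form a compact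
  semigroup, so \<open>u\<close> is one of them. The compactness claims hold because
  \<open>\<phi> \<mapsto> \<phi> \<circ> u\<close> is continuous for pointwise convergence, whatever the map \<open>u\<close> is.
\<close>

lemma compact_semigroup_idempotent:
  fixes S :: "('a::t2_space \<Rightarrow> 'a) set"
  assumes "compact_semigroup S"
  obtains u where "u \<in> S" "u \<circ> u = u"
proof -
  obtain M where M: "compact_semigroup M" "M \<subseteq> S"
    and min: "\<And>T. compact_semigroup T \<Longrightarrow> T \<subseteq> M \<Longrightarrow> T = M"
    using minimal_compact_semigroup[OF assms] by blast
  have comp: "\<phi> \<circ> \<psi> \<in> M" if "\<phi> \<in> M" "\<psi> \<in> M" for \<phi> \<psi>
    using M that by (simp add: compact_semigroup_def)
  obtain u where u: "u \<in> M" using M by (auto simp: compact_semigroup_def)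
  have "compact_semigroup ((\<lambda>\<phi>. \<phi> \<circ> u) ` M)"
    unfolding compact_semigroup_def
  proof (intro conjI ballI)
    show "compact ((\<lambda>\<phi>. \<phi> \<circ> u) ` M)"
      using M by (intro compact_continuous_image continuous_on_precomp)
        (simp add: compact_semigroup_def)
    fix \<phi> \<psi> assume "\<phi> \<in> (\<lambda>\<phi>. \<phi> \<circ> u) ` M" "\<psi> \<in> (\<lambda>\<phi>. \<phi> \<circ> u) ` M"
    then obtain \<phi>' \<psi>' where *: "\<phi>' \<in> M" "\<psi>' \<in> M" "\<phi> = \<phi>' \<circ> u" "\<psi> = \<psi>' \<circ> u" by blast
    then have "\<phi>' \<circ> u \<circ> \<psi>' \<in> M" using comp u by blast
    moreover have "\<phi> \<circ> \<psi> = (\<phi>' \<circ> u \<circ> \<psi>') \<circ> u" using * by (simp add: comp_assoc)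
    ultimately show "\<phi> \<circ> \<psi> \<in> (\<lambda>\<phi>. \<phi> \<circ> u) ` M" by blast
  qed (use u in blast)
  then have "(\<lambda>\<phi>. \<phi> \<circ> u) ` M = M" using comp u by (intro min) auto
  then obtain \<phi> where \<phi>: "\<phi> \<in> M" "\<phi> \<circ> u = u" using u by (metis (no_types, lifting) imageE)
  define W where "W = {\<phi>\<in>M. \<phi> \<circ> u = u}"
  have "compact_semigroup W"
    unfolding compact_semigroup_def
  proof (intro conjI ballI)
    have "closed ((\<lambda>\<phi>. \<phi> \<circ> u) -` {u})"
      using compact_imp_closed_fun[of "{u}"]
      by (intro closed_vimage continuous_on_precomp) auto
    moreover have "W = M \<inter> (\<lambda>\<phi>. \<phi> \<circ> u) -` {u}" by (auto simp: W_def)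
    ultimately show "compact W"
      using M by (simp add: compact_semigroup_def compact_Int_closed)
    show "\<phi> \<circ> \<psi> \<in> W" if "\<phi> \<in> W" "\<psi> \<in> W" for \<phi> \<psi>
      using that comp by (simp add: W_def comp_assoc)
  qed (use \<phi> W_def in blast)
  then have "W = M" by (rule min) (simp add: W_def)
  then show ?thesis using u M that by (auto simp: W_def)
qed

section \<open>Joint recurrence of distal maps\<close>

definition forward_distal :: "'a::metric_space set \<Rightarrow> ('a \<Rightarrow> 'a) \<Rightarrow> bool" where
  "forward_distal X h \<longleftrightarrow>
     (\<forall>x\<in>X. \<forall>y\<in>X. x \<noteq> y \<longrightarrow> (\<exists>c>0. \<forall>n. c \<le> dist ((h ^^ n) x) ((h ^^ n) y)))"

definition jointly_recurrent :: "'a::metric_space set \<Rightarrow> ('a \<Rightarrow> 'a) \<Rightarrow> bool" where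
  "jointly_recurrent X h \<longleftrightarrow>
     (\<forall>F m \<eta>. finite F \<and> F \<subseteq> X \<and> \<eta> > 0 \<longrightarrow> (\<exists>n\<ge>m. \<forall>x\<in>F. dist ((h ^^ n) x) x < \<eta>))"

lemma funpow_in:
  assumes "h ` X \<subseteq> X" "x \<in> X"
  shows "(h ^^ n) x \<in> X"
  by (induction n) (use assms in auto)

lemma continuous_on_funpow:
  assumes "continuous_on X h" "h ` X \<subseteq> X"
  shows "continuous_on X (h ^^ n)"
proof (induction n)
  case 0
  then show ?case by (simp add: id_def)
next
  case (Suc n)
  have "(h ^^ n) ` X \<subseteq> X" using funpow_in[OF assms(2)] by blast
  then have "continuous_on X (\<lambda>x. h ((h ^^ n) x))"
    by (rule continuous_on_compose2[OF assms(1) Suc])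
  then show ?case by (simp add: o_def)
qed

text \<open>
  The semigroup is the closure of the iterates of order at least \<open>m\<close>. Composition on the left is
  continuous only for continuous maps, so closedness under composition is shown first with an
  iterate on the left and then extended to the closure by continuity of composition on the right.
\<close>

lemma forward_distal_imp_jointly_recurrent:
  fixes X :: "'a::metric_space set"
  assumes X: "compact X" and cont: "continuous_on X h" and inv: "h ` X \<subseteq> X"
    and distal: "forward_distal X h"
  shows "jointly_recurrent X h"
  unfolding jointly_recurrent_def
proof (intro allI impI, elim conjE)
  fix F m and \<eta> :: real
  assume F: "finite F" "F \<subseteq> X" and \<eta>: "\<eta> > 0"
  \<comment> \<open>Extending the iterates by the identity off \<open>X\<close> keeps them all inside one product of compact sets.\<close>
  define G where "G = (\<lambda>n x. if x \<in> X then (h ^^ n) x else x)"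
  define K where "K = Pi\<^sub>E UNIV (\<lambda>x. if x \<in> X then X else {x})"
  define A where "A = G ` {m..}"
  define E where "E = closure A"
  have K_iff: "\<phi> \<in> K \<longleftrightarrow> (\<forall>x. if x \<in> X then \<phi> x \<in> X else \<phi> x = x)" for \<phi>
    by (auto simp: K_def PiE_iff)
  have "compactin (product_topology (\<lambda>_. euclidean) UNIV) K"
    unfolding K_def compactin_PiE using X by auto
  then have K: "compact K" by (simp add: euclidean_product_topology)
  have GK: "G n \<in> K" for n
    unfolding K_iff G_def using funpow_in[OF inv] by auto
  have GG: "G i \<circ> G j = G (i + j)" for i j
    by (rule ext) (auto simp: G_def funpow_add funpow_in[OF inv])
  have EK: "E \<subseteq> K"
    unfolding E_def using GK K compact_imp_closed_fun
    by (intro closure_minimal) (auto simp: A_def)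
  have cE: "closed E" by (simp add: E_def)
  have G_left: "G i \<circ> \<psi> \<in> E" if "i \<ge> m" "\<psi> \<in> E" for i \<psi>
  proof -
    have "(\<lambda>\<psi>. G i \<circ> \<psi>) ` closure A \<subseteq> E"
    proof (rule image_closure_subset)
      have "continuous_on K (\<lambda>\<psi>. (G i \<circ> \<psi>) x)" for x
      proof (cases "x \<in> X")
        case True
        have coord: "continuous_on K (\<lambda>\<psi>. \<psi> x)"
          by (rule continuous_on_subset[OF continuous_on_product_coordinates]) simp
        have "continuous_on K (\<lambda>\<psi>. (h ^^ i) (\<psi> x))"
          by (rule continuous_on_compose2[OF continuous_on_funpow[OF cont inv] coord])
            (use True K_iff in auto)
        then show ?thesis
          by (rule continuous_on_eq) (use True K_iff in \<open>auto simp: G_def\<close>)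
      next
        case False
        have "continuous_on K (\<lambda>\<psi>. x)" by simp
        then show ?thesis
          by (rule continuous_on_eq) (use False K_iff in \<open>auto simp: G_def\<close>)
      qed
      then have "continuous_on K (\<lambda>\<psi>. G i \<circ> \<psi>)"
        by (rule continuous_on_coordinatewise_then_product)
      then show "continuous_on (closure A) (\<lambda>\<psi>. G i \<circ> \<psi>)"
        using EK continuous_on_subset unfolding E_def by blast
      show "(\<lambda>\<psi>. G i \<circ> \<psi>) ` A \<subseteq> E"
        unfolding E_def using that closure_subset[of A]
        by (fastforce simp: A_def GG)
    qed (rule cE)
    then show ?thesis using that by (auto simp: E_def)
  qed
  have comp: "\<phi> \<circ> \<psi> \<in> E" if "\<phi> \<in> E" "\<psi> \<in> E" for \<phi> \<psi>
  proof -
    have "(\<lambda>\<phi>. \<phi> \<circ> \<psi>) ` closure A \<subseteq> E"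
      using G_left[OF _ that(2)]
      by (intro image_closure_subset continuous_on_precomp cE) (auto simp: A_def)
    then show ?thesis using that by (auto simp: E_def)
  qed
  have "compact (K \<inter> E)" using K cE by (rule compact_Int_closed)
  then have "compact E" using EK by (simp add: Int_absorb1)
  moreover have "E \<noteq> {}" by (simp add: E_def A_def)
  ultimately have "compact_semigroup E" using comp by (simp add: compact_semigroup_def)
  then obtain u where u: "u \<in> E" "u \<circ> u = u" by (rule compact_semigroup_idempotent)
  have u_id: "u x = x" if x: "x \<in> X" for x
  proof (rule ccontr)
    assume ne: "u x \<noteq> x"
    have ux: "u x \<in> X" using u EK x K_iff by (metis subsetD)
    obtain c where c: "c > 0" "\<And>n. c \<le> dist ((h ^^ n) (u x)) ((h ^^ n) x)"
      using distal ne x ux unfolding forward_distal_def by metis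
    have "closed {\<phi>. c \<le> dist (\<phi> (u x)) (\<phi> x)}"
      by (intro closed_Collect_le continuous_intros continuous_on_product_coordinates)
    moreover have "A \<subseteq> {\<phi>. c \<le> dist (\<phi> (u x)) (\<phi> x)}"
      using c x ux by (auto simp: A_def G_def)
    ultimately have "E \<subseteq> {\<phi>. c \<le> dist (\<phi> (u x)) (\<phi> x)}"
      unfolding E_def by (intro closure_minimal)
    then have "c \<le> dist (u (u x)) (u x)" using u by blast
    then show False using c u(2) by (simp add: fun_eq_iff)
  qed
  let ?U = "{\<phi>. \<forall>x\<in>F. \<phi> x \<in> ball x \<eta>}"
  have "open ?U" by (rule product_topology_basis'[OF F(1)]) simp
  moreover have "u \<in> ?U" using u_id F \<eta> by auto
  ultimately have "?U \<inter> A \<noteq> {}"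
    using u(1) unfolding E_def closure_iff_nhds_not_empty by blast
  then obtain n where "n \<ge> m" "\<forall>x\<in>F. G n x \<in> ball x \<eta>" by (auto simp: A_def)
  then show "\<exists>n\<ge>m. \<forall>x\<in>F. dist ((h ^^ n) x) x < \<eta>"
    using F by (intro exI[of _ n]) (auto simp: G_def dist_commute subset_iff)
qed

section \<open>Chains inside a connected set\<close>

definition finite_chain ::
    "'a::metric_space set \<Rightarrow> ('a \<Rightarrow> 'a) \<Rightarrow> real \<Rightarrow> nat \<Rightarrow> (nat \<Rightarrow> 'a) \<Rightarrow> bool" where
  "finite_chain X f \<delta> N \<xi> \<longleftrightarrow>
     (\<forall>i\<le>N. \<xi> i \<in> X) \<and> (\<forall>i<N. dist (f (\<xi> i)) (\<xi> (Suc i)) \<le> \<delta>)"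

text \<open>
  The chain is prolonged by an orbit segment of \<open>q\<close> of length \<open>k\<close> whose end is replaced by \<open>q'\<close>.
  Here \<open>k\<close> is a common return time of \<open>q\<close> and \<open>p\<close>, chosen after \<open>N\<close>: by continuity of the
  \<open>N\<close>-th iterate, a sufficiently close return of \<open>p\<close> moves its \<open>N\<close>-th iterate by less than the slack
  left in the strict inequality on \<open>dist ((f ^^ N) p) p\<close>.
\<close>

lemma chain_extend:
  assumes rec: "jointly_recurrent X f" and cont: "continuous_on X f" and inv: "f ` X \<subseteq> X"
    and p: "p \<in> X" and q': "q' \<in> X" "dist q q' < \<delta>" and \<delta>: "0 < \<delta>"
    and chain: "finite_chain X f \<delta> N \<xi>" "\<xi> 0 = p" "\<xi> N = q" "dist ((f ^^ N) p) p < \<eta>"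
  shows "\<exists>N \<xi>. finite_chain X f \<delta> N \<xi> \<and> \<xi> 0 = p \<and> \<xi> N = q' \<and> dist ((f ^^ N) p) p < \<eta>"
proof -
  have q: "q \<in> X" using chain by (auto simp: finite_chain_def)
  obtain \<rho> where \<rho>: "\<rho> > 0"
    "\<And>y. y \<in> X \<Longrightarrow> dist y p < \<rho> \<Longrightarrow> dist ((f ^^ N) y) ((f ^^ N) p) < \<eta> - dist ((f ^^ N) p) p"
    using continuous_on_funpow[OF cont inv, of N] p chain(4)
    unfolding continuous_on_iff by (metis diff_gt_0_iff_gt)
  obtain k where k: "k \<ge> 1" "\<And>x. x \<in> {p, q} \<Longrightarrow> dist ((f ^^ k) x) x < min \<rho> (\<delta> - dist q q')"
    using rec[unfolded jointly_recurrent_def, rule_format, of "{p, q}" "min \<rho> (\<delta> - dist q q')" 1]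
      p q \<rho>(1) q'(2) by auto
  define \<zeta> where "\<zeta> = (\<lambda>i. if i \<le> N then \<xi> i else if i < N + k then (f ^^ (i - N)) q else q')"
  have step: "dist (f (\<zeta> i)) (\<zeta> (Suc i)) \<le> \<delta>" if "i < N + k" for i
  proof (cases "i < N")
    case True
    then show ?thesis using chain by (simp add: \<zeta>_def finite_chain_def)
  next
    case False
    have "\<zeta> i = (f ^^ (i - N)) q" using False that chain by (simp add: \<zeta>_def)
    then have eq: "f (\<zeta> i) = (f ^^ (Suc i - N)) q" using False by (simp add: Suc_diff_le)
    show ?thesis
    proof (cases "Suc i < N + k")
      case True
      then show ?thesis using eq False \<delta> by (simp add: \<zeta>_def)
    next
      case last: False
      then have "Suc i = N + k" using that by simp
      then have "f (\<zeta> i) = (f ^^ k) q" "\<zeta> (Suc i) = q'" using eq k by (auto simp: \<zeta>_def)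
      moreover have "dist ((f ^^ k) q) q' \<le> \<delta>"
        using k(2)[of q] dist_triangle[of "(f ^^ k) q" q' q] by simp
      ultimately show ?thesis by simp
    qed
  qed
  have "finite_chain X f \<delta> (N + k) \<zeta>"
    using chain q' funpow_in[OF inv q] step by (auto simp: finite_chain_def \<zeta>_def)
  moreover have "\<zeta> 0 = p" "\<zeta> (N + k) = q'" using chain k by (auto simp: \<zeta>_def)
  moreover have "dist ((f ^^ (N + k)) p) p < \<eta>"
  proof -
    have "dist ((f ^^ N) ((f ^^ k) p)) ((f ^^ N) p) < \<eta> - dist ((f ^^ N) p) p"
      using \<rho>(2)[OF funpow_in[OF inv p]] k(2)[of p] by simp
    then show ?thesis
      using dist_triangle[of "(f ^^ (N + k)) p" p "(f ^^ N) p"] by (simp add: funpow_add)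
  qed
  ultimately show ?thesis by blast
qed

text \<open>
  Any two points of a ball of radius \<open>\<delta> / 2\<close> are close enough for an extension step, so the set
  of reachable points is relatively open in \<open>C\<close> and so is its complement.
\<close>

lemma chain_within_connected:
  assumes rec: "jointly_recurrent X f" and cont: "continuous_on X f" and inv: "f ` X \<subseteq> X"
    and C: "connected C" "C \<subseteq> X" "p \<in> C" "q \<in> C" and pos: "\<delta> > 0" "\<eta> > 0"
  shows "\<exists>N \<xi>. finite_chain X f \<delta> N \<xi> \<and> \<xi> 0 = p \<and> \<xi> N = q \<and> dist ((f ^^ N) p) p < \<eta>"
    (is "?P q")
proof (rule connected_induction_simple[OF C(1,3,4)])
  have p: "p \<in> X" using C by auto
  show "?P p"
    by (rule exI[of _ 0], rule exI[of _ "\<lambda>_. p"]) (use p pos in \<open>simp add: finite_chain_def\<close>)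
  fix a assume a: "a \<in> C"
  show "\<exists>T. openin (top_of_set C) T \<and> a \<in> T \<and> (\<forall>x\<in>T. \<forall>y\<in>T. ?P x \<longrightarrow> ?P y)"
  proof (intro exI[of _ "C \<inter> ball a (\<delta> / 2)"] conjI ballI impI)
    show "openin (top_of_set C) (C \<inter> ball a (\<delta> / 2))" by (simp add: openin_open_Int)
    show "a \<in> C \<inter> ball a (\<delta> / 2)" using a pos by simp
    fix x y assume x: "x \<in> C \<inter> ball a (\<delta> / 2)" and y: "y \<in> C \<inter> ball a (\<delta> / 2)"
    have "dist x y < \<delta>"
      using x y dist_triangle_half_r[of a x \<delta> y] by (simp add: dist_commute)
    moreover assume "?P x"
    ultimately show "?P y"
      using chain_extend[OF rec cont inv p _ _ pos(1)] y C(2) by blast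
  qed
qed

section \<open>Shadowable points of distal homeomorphisms\<close>

lemma int_iterate_of_nat: "int_iterate X f (int n) = f ^^ n"
  by (simp add: int_iterate_def)

lemma int_iterate_minus_of_nat: "int_iterate X f (- int n) = inv_into X f ^^ n"
  by (simp add: int_iterate_def)

lemma distal_lower_bound:
  assumes "distal X f" "x \<in> X" "y \<in> X" "x \<noteq> y"
  obtains c where "c > 0" "\<And>n. c \<le> dist (int_iterate X f n x) (int_iterate X f n y)"
proof (rule that)
  show "(INF n. dist (int_iterate X f n x) (int_iterate X f n y)) > 0"
    using assms by (simp add: distal_def)
  show "(INF n. dist (int_iterate X f n x) (int_iterate X f n y))
      \<le> dist (int_iterate X f n x) (int_iterate X f n y)" for n
    by (rule cINF_lower) (auto intro: bdd_belowI[of _ 0])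
qed

lemma distal_imp_forward_distal:
  assumes "distal X f"
  shows "forward_distal X f" and "forward_distal X (inv_into X f)"
proof -
  show "forward_distal X f"
    unfolding forward_distal_def by (metis int_iterate_of_nat distal_lower_bound[OF assms])
  show "forward_distal X (inv_into X f)"
    unfolding forward_distal_def by (metis int_iterate_minus_of_nat distal_lower_bound[OF assms])
qed

lemma inv_into_cancel_funpow:
  assumes f: "inj_on f X" "f ` X \<subseteq> X" and x: "x \<in> X" and k: "N \<le> k"
  shows "(inv_into X f ^^ k) ((f ^^ N) x) = (inv_into X f ^^ (k - N)) x"
proof -
  let ?g = "inv_into X f"
  have cancel: "(?g ^^ N) ((f ^^ N) x) = x"
  proof (induction N)
    case (Suc N)
    have "?g (f ((f ^^ N) x)) = (f ^^ N) x"
      by (rule inv_into_f_f[OF f(1) funpow_in[OF f(2) x]])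
    then show ?case
      using Suc by (simp add: funpow_swap1)
  qed simp
  have "?g ^^ k = ?g ^^ (k - N) \<circ> ?g ^^ N"
    unfolding funpow_add[symmetric] using k by simp
  then show ?thesis by (simp add: cancel)
qed

text \<open>
  A time \<open>k \<ge> N\<close> at which the inverse almost returns both \<open>f\<^sup>N x\<close> and \<open>f\<^sup>N y\<close> carries them to
  points of the backward orbits of \<open>x\<close> and \<open>y\<close> at the same time, where the bound is known.
\<close>

lemma backward_close_imp_forward_close:
  assumes rec: "jointly_recurrent X (inv_into X f)" and f: "inj_on f X" "f ` X \<subseteq> X"
    and xy: "x \<in> X" "y \<in> X"
    and close: "\<And>k. dist ((inv_into X f ^^ k) x) ((inv_into X f ^^ k) y) \<le> \<epsilon>"
  shows "dist ((f ^^ N) x) ((f ^^ N) y) \<le> \<epsilon>"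
proof (rule field_le_epsilon)
  fix e :: real assume e: "e > 0"
  let ?x = "(f ^^ N) x" and ?y = "(f ^^ N) y" and ?g = "inv_into X f"
  have "?x \<in> X" "?y \<in> X" using funpow_in[OF f(2)] xy by auto
  then obtain k where k: "k \<ge> N" "dist ((?g ^^ k) ?x) ?x < e / 2" "dist ((?g ^^ k) ?y) ?y < e / 2"
    using rec[unfolded jointly_recurrent_def, rule_format, of "{?x, ?y}" "e / 2" N] e by auto
  have "dist ((?g ^^ k) ?x) ((?g ^^ k) ?y) \<le> \<epsilon>"
    using inv_into_cancel_funpow[OF f _ k(1)] xy close by simp
  then show "dist ?x ?y \<le> \<epsilon> + e"
    using k dist_triangle[of ?x ?y "(?g ^^ k) ?x"]
      dist_triangle[of "(?g ^^ k) ?x" ?y "(?g ^^ k) ?y"]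
    by (simp add: dist_commute)
qed

lemma pseudo_orbit_through_chain:
  assumes f: "f ` X = X" and chain: "finite_chain X f \<delta> N \<xi>" and \<delta>: "0 \<le> \<delta>"
  obtains \<zeta> where "pseudo_orbit X f \<delta> \<zeta>" "\<And>k. \<zeta> (- int k) = (inv_into X f ^^ k) (\<xi> 0)"
    "\<zeta> (int N) = \<xi> N"
proof -
  let ?g = "inv_into X f"
  define \<zeta> where "\<zeta> = (\<lambda>n. if n \<le> 0 then (?g ^^ nat (- n)) (\<xi> 0)
    else if n \<le> int N then \<xi> (nat n) else (f ^^ (nat n - N)) (\<xi> N))"
  have inX: "\<xi> 0 \<in> X" "\<xi> N \<in> X" using chain by (auto simp: finite_chain_def)
  have g: "?g ` X \<subseteq> X" by (metis f image_subsetI inv_into_into)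
  have nonneg: "\<zeta> (int i) = (if i \<le> N then \<xi> i else (f ^^ (i - N)) (\<xi> N))" for i
    by (auto simp: \<zeta>_def)
  have neg: "\<zeta> (- int k) = (?g ^^ k) (\<xi> 0)" for k by (simp add: \<zeta>_def)
  have "pseudo_orbit X f \<delta> \<zeta>"
    unfolding pseudo_orbit_def
  proof (intro conjI allI)
    fix n :: int
    show "\<zeta> n \<in> X"
      using chain funpow_in[OF g inX(1)] funpow_in[OF equalityD1[OF f] inX(2)]
      by (auto simp: \<zeta>_def finite_chain_def)
    show "dist (f (\<zeta> n)) (\<zeta> (n + 1)) \<le> \<delta>"
    proof (cases "n < 0")
      case True
      then obtain k where k: "n = - int (Suc k)" by (metis negD)
      have "f (?g ((?g ^^ k) (\<xi> 0))) = (?g ^^ k) (\<xi> 0)"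
        using funpow_in[OF g inX(1)] f by (simp add: f_inv_into_f)
      then have "f (\<zeta> (- int (Suc k))) = \<zeta> (- int k)" unfolding neg by simp
      moreover have "n + 1 = - int k" using k by simp
      ultimately have "f (\<zeta> n) = \<zeta> (n + 1)" using k by simp
      then show ?thesis using \<delta> by simp
    next
      case False
      then obtain i where i: "n = int i" by (metis nonneg_int_cases not_less)
      then have "n + 1 = int (Suc i)" by simp
      moreover have "dist (f (\<zeta> (int i))) (\<zeta> (int (Suc i))) \<le> \<delta>"
      proof (cases "i < N")
        case True
        then show ?thesis unfolding nonneg using chain by (simp add: finite_chain_def)
      next
        case False
        then have "f (\<zeta> (int i)) = \<zeta> (int (Suc i))"
          unfolding nonneg by (auto simp: Suc_diff_le)
        then show ?thesis using \<delta> by simp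
      qed
      ultimately show ?thesis by (metis i)
    qed
  qed
  then show ?thesis by (rule that) (use neg nonneg in auto)
qed

theorem theorem1p5:
  fixes X :: "'a::metric_space set" and f :: "'a \<Rightarrow> 'a"
  assumes "compact X"
    and "self_homeomorphism X f"
    and "distal X f"
  shows "Sh X f \<subseteq> Xdeg X"
proof
  fix p assume "p \<in> Sh X f"
  then have p: "p \<in> X" and sh: "shadowable_point X f p" by (auto simp: Sh_def)
  let ?g = "inv_into X f"
  obtain g' where hom: "homeomorphism X X f g'"
    using assms(2) by (auto simp: self_homeomorphism_def)
  have f: "f ` X = X" and cont: "continuous_on X f" and inj: "inj_on f X"
    using hom by (auto simp: homeomorphism_def intro: inj_on_inverseI)
  have gg': "?g y = g' y" if "y \<in> X" for y
    using hom inj that by (intro inv_into_f_eq) (auto simp: homeomorphism_def)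
  have g: "?g ` X \<subseteq> X" by (metis f image_subsetI inv_into_into)
  have "continuous_on X g'" using hom by (simp add: homeomorphism_def)
  then have contg: "continuous_on X ?g" by (rule continuous_on_eq) (simp add: gg')
  have recf: "jointly_recurrent X f"
    using assms(1) cont equalityD1[OF f] distal_imp_forward_distal(1)[OF assms(3)]
    by (rule forward_distal_imp_jointly_recurrent)
  have recg: "jointly_recurrent X ?g"
    using assms(1) contg g distal_imp_forward_distal(2)[OF assms(3)]
    by (rule forward_distal_imp_jointly_recurrent)
  let ?C = "connected_component_set X p"
  have "q = p" if q: "q \<in> ?C" for q
  proof (rule ccontr)
    assume "q \<noteq> p"
    \<comment> \<open>Return of \<open>p\<close>, forward closeness to \<open>x\<close> and shadowing of \<open>q\<close> each cost one \<open>\<epsilon>\<close>.\<close>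
    define \<epsilon> where "\<epsilon> = dist p q / 4"
    have \<epsilon>: "\<epsilon> > 0" using \<open>q \<noteq> p\<close> by (simp add: \<epsilon>_def)
    obtain \<delta> where \<delta>: "\<delta> > 0"
      "\<And>\<xi>. pseudo_orbit X f \<delta> \<xi> \<Longrightarrow> \<xi> 0 = p \<Longrightarrow> can_be_shadowed X f \<epsilon> \<xi>"
      using sh \<epsilon> unfolding shadowable_point_def by blast
    have "p \<in> ?C" using p by simp
    then obtain N \<xi> where \<xi>: "finite_chain X f \<delta> N \<xi>" "\<xi> 0 = p" "\<xi> N = q"
      and ret: "dist ((f ^^ N) p) p < \<epsilon>"
      using chain_within_connected[OF recf cont equalityD1[OF f] connected_connected_component
          connected_component_subset _ q \<delta>(1) \<epsilon>] by blast
    obtain \<zeta> where \<zeta>: "pseudo_orbit X f \<delta> \<zeta>" "\<And>k. \<zeta> (- int k) = (?g ^^ k) (\<xi> 0)"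
      "\<zeta> (int N) = \<xi> N"
      using pseudo_orbit_through_chain[OF f \<xi>(1)] \<delta>(1) by (metis less_imp_le)
    have "\<zeta> 0 = p" using \<zeta>(2)[of 0] \<xi>(2) by simp
    then obtain x where x: "x \<in> X" "\<And>n. dist (int_iterate X f n x) (\<zeta> n) \<le> \<epsilon>"
      using \<delta>(2)[OF \<zeta>(1)] by (auto simp: can_be_shadowed_def)
    have "dist ((?g ^^ k) x) ((?g ^^ k) p) \<le> \<epsilon>" for k
      using x(2)[of "- int k"] unfolding int_iterate_minus_of_nat \<zeta>(2) \<xi>(2) .
    then have "dist ((f ^^ N) x) ((f ^^ N) p) \<le> \<epsilon>"
      by (rule backward_close_imp_forward_close[OF recg inj equalityD1[OF f] x(1) p])
    moreover have "dist ((f ^^ N) x) q \<le> \<epsilon>"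
      using x(2)[of "int N"] unfolding int_iterate_of_nat \<zeta>(3) \<xi>(3) .
    ultimately have "dist p q < 3 * \<epsilon>"
      using ret dist_triangle[of p q "(f ^^ N) p"] dist_triangle[of "(f ^^ N) p" q "(f ^^ N) x"]
      by (simp add: dist_commute)
    then show False using \<epsilon> by (simp add: \<epsilon>_def)
  qed
  then have "?C = {p}" using p by auto
  then show "p \<in> Xdeg X" using p by (simp add: Xdeg_def totally_disconnected_at_def)
qed

end
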